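(* Let $N\ge 1$, $k\ge 0$, and let $D_k=\sum_{i=0}^k\partial^iF_i(t)$, $\partial=\frac{d}{dt}$, be a right-hand side differential operator of order $k$, where each $F_i(t)$ ($i=0,\dots,k$) is an $N\times N$ complex matrix polynomial of degree less than or equal to $i$ (so $F_0$ is a constant matrix). Let $W$ be an $N\times N$ weight matrix. Assume that associated with the real point $t_0\in\mathbb{R}$ there exists a Hermitian positive semidefinite matrix $M(t_0)\in\mathbb{C}^{N\times N}$ satisfying $$F_j(t_0)M(t_0)=0,\quad j=1,\ldots,k,\qquad\text{and}\qquad F_0M(t_0)=M(t_0)F_0^*.$$ Then the operator $D_k$ is symmetric with respect to $W$ if and only if it is symmetric with respect to $\widetilde W=W+\delta_{t_0}M(t_0)$.
   Context: A weight matrix $W$ is an $N\times N$ matrix of measures supported in the real line such that: $W(\Omega)$ is positive semidefinite for every Borel set $\Omega\subset\mathbb{R}$; for every $n\in\mathbb{N}$ the moment $\mu_n=\int t^n\,dW(t)$ exists and is finite; and $\int P(t)\,dW(t)\,P^*(t)$ is nonsingular whenever $P$ is an $N\times N$ matrix polynomial with nonsingular leading coefficient. Here $P^*(t)$ is the conjugate transpose of $P(t)$. The operator $D_k$ acts on the right on matrix polynomials $P$ by $PD_k=\sum_{i=0}^kP^{(i)}(t)F_i(t)$. It is symmetric with respect to $W$ if $\int (PD_k)\,dW\,Q^*=\int P\,dW\,(QD_k)^*$ for all $N\times N$ matrix polynomials $P,Q$. $\delta_{t_0}$ denotes the Dirac measure at $t_0$ (unit point mass), so $\delta_{t_0}M(t_0)$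 is the matrix of measures consisting of the point mass $M(t_0)$ at $t_0$. *)

theory Defs
  imports "HOL-Analysis.Analysis" "HOL-Computational_Algebra.Polynomial"
begin

subsection \<open>Complex measures\<close>

definition complex_measure :: "'a measure \<Rightarrow> ('a set \<Rightarrow> complex) \<Rightarrow> bool" where
  "complex_measure M \<nu> \<longleftrightarrow>
     \<nu> {} = 0 \<and>
     (\<forall>A :: nat \<Rightarrow> 'a set. range A \<subseteq> sets M \<longrightarrow> disjoint_family A \<longrightarrow>
        (\<lambda>n. \<nu> (A n)) sums \<nu> (\<Union>n. A n))"

text \<open>The positive part of the Jordan decomposition of a signed measure \<open>\<nu>\<close>; the negative part
  is the positive part of \<open>-\<nu>\<close>. The function \<open>ennreal\<close> sends negative values to \<open>0\<close>, which is
  harmless since \<open>\<nu> {} = 0\<close> already contributes to the supremum.\<close>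

definition pos_variation :: "'a measure \<Rightarrow> ('a set \<Rightarrow> real) \<Rightarrow> 'a measure" where
  "pos_variation M \<nu> =
     measure_of (space M) (sets M) (\<lambda>A. SUP B\<in>{B \<in> sets M. B \<subseteq> A}. ennreal (\<nu> B))"

definition signed_integrable ::
    "'a measure \<Rightarrow> ('a set \<Rightarrow> real) \<Rightarrow> ('a \<Rightarrow> complex) \<Rightarrow> bool" where
  "signed_integrable M \<nu> f \<longleftrightarrow>
     integrable (pos_variation M \<nu>) f \<and> integrable (pos_variation M (\<lambda>A. - \<nu> A)) f"

definition signed_integral ::
    "'a measure \<Rightarrow> ('a set \<Rightarrow> real) \<Rightarrow> ('a \<Rightarrow> complex) \<Rightarrow> complex" where
  "signed_integral M \<nu> f =
     (LINT x|pos_variation M \<nu>. f x) - (LINT x|pos_variation M (\<lambda>A. - \<nu> A). f x)"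

definition complex_integrable ::
    "'a measure \<Rightarrow> ('a set \<Rightarrow> complex) \<Rightarrow> ('a \<Rightarrow> complex) \<Rightarrow> bool" where
  "complex_integrable M \<nu> f \<longleftrightarrow>
     signed_integrable M (\<lambda>A. Re (\<nu> A)) f \<and> signed_integrable M (\<lambda>A. Im (\<nu> A)) f"

definition complex_integral ::
    "'a measure \<Rightarrow> ('a set \<Rightarrow> complex) \<Rightarrow> ('a \<Rightarrow> complex) \<Rightarrow> complex" where
  "complex_integral M \<nu> f =
     signed_integral M (\<lambda>A. Re (\<nu> A)) f + \<i> * signed_integral M (\<lambda>A. Im (\<nu> A)) f"

text \<open>For a finite positive measure this is the Lebesgue integral of the library.\<close>

lemma pos_variation_measure:
  assumes "finite_measure M"
  shows "pos_variation M (measure M) = M"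
proof -
  interpret finite_measure M by fact
  have "(SUP B\<in>{B \<in> sets M. B \<subseteq> A}. ennreal (measure M B)) = emeasure M A" if "A \<in> sets M" for A
    using that by (intro antisym SUP_least SUP_upper2[of A])
      (auto simp: emeasure_eq_measure[symmetric] intro: emeasure_mono)
  then have "pos_variation M (measure M) = measure_of (space M) (sets M) (emeasure M)"
    unfolding pos_variation_def
    by (intro measure_of_eq) (auto simp: sets.space_closed sets.sigma_sets_eq)
  then show ?thesis by (simp add: measure_of_of_measure)
qed

lemma pos_variation_nonpos:
  assumes "\<And>A. \<nu> A \<le> 0"
  shows "pos_variation M \<nu> = null_measure M"
proof (rule measure_eqI)
  fix A assume "A \<in> sets (pos_variation M \<nu>)"
  have "(\<lambda>A. SUP B\<in>{B \<in> sets M. B \<subseteq> A}. ennreal (\<nu> B)) = (\<lambda>_. 0)"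
    using assms by (auto simp: ennreal_neg SUP_eq_const bot_ennreal intro!: ext antisym SUP_least)
  then show "emeasure (pos_variation M \<nu>) A = emeasure (null_measure M) A"
    by (simp add: pos_variation_def emeasure_sigma)
qed (simp add: pos_variation_def sets.space_closed)

lemma complex_integral_measure:
  assumes "finite_measure M"
  shows "complex_integral M (\<lambda>A. complex_of_real (measure M A)) f = (LINT x|M. f x)"
  using assms
  by (simp add: complex_integral_def signed_integral_def pos_variation_measure
      pos_variation_nonpos)

subsection \<open>Complex matrices and matrix polynomials\<close>

definition ctranspose :: "complex^'n^'m \<Rightarrow> complex^'m^'n" where
  "ctranspose A = (\<chi> i j. cnj (A $ j $ i))"

definition hermitian :: "complex^'n^'n \<Rightarrow> bool" where
  "hermitian A \<longleftrightarrow> ctranspose A = A"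

definition pos_semidef :: "complex^'n^'n \<Rightarrow> bool" where
  "pos_semidef A \<longleftrightarrow>
     hermitian A \<and> (\<forall>x :: complex^'n. 0 \<le> Re (\<Sum>i\<in>UNIV. \<Sum>j\<in>UNIV. cnj (x $ i) * A $ i $ j * x $ j))"

type_synonym 'n mpoly = "complex poly^'n^'n"

definition mpoly_eval :: "'n::finite mpoly \<Rightarrow> real \<Rightarrow> complex^'n^'n" where
  "mpoly_eval P t = map_matrix (\<lambda>p. poly p (complex_of_real t)) P"

definition mpoly_coeff :: "'n::finite mpoly \<Rightarrow> nat \<Rightarrow> complex^'n^'n" where
  "mpoly_coeff P m = map_matrix (\<lambda>p. coeff p m) P"

definition mpoly_degree :: "'n::finite mpoly \<Rightarrow> nat" where
  "mpoly_degree P = Max (range (\<lambda>(i, j). degree (P $ i $ j)))"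

definition mpoly_lead_coeff :: "'n::finite mpoly \<Rightarrow> complex^'n^'n" where
  "mpoly_lead_coeff P = mpoly_coeff P (mpoly_degree P)"

definition mpoly_deriv :: "'n::finite mpoly \<Rightarrow> 'n mpoly" where
  "mpoly_deriv P = map_matrix pderiv P"

subsection \<open>Weight matrices\<close>

text \<open>A matrix of measures on the real line is represented by its matrix-valued set function
  \<open>W\<close>; only the values on Borel sets matter.\<close>

definition matrix_integral ::
    "(real set \<Rightarrow> complex^'n^'n) \<Rightarrow> 'n::finite mpoly \<Rightarrow> 'n mpoly \<Rightarrow> complex^'n^'n" where
  \<comment> \<open>the integral of \<open>P dW Q\<^sup>*\<close>\<close>
  "matrix_integral W P Q =
     (\<chi> i j. \<Sum>k\<in>UNIV. \<Sum>l\<in>UNIV.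
        complex_integral borel (\<lambda>\<Omega>. W \<Omega> $ k $ l)
          (\<lambda>t. mpoly_eval P t $ i $ k * ctranspose (mpoly_eval Q t) $ l $ j))"

definition weight_matrix :: "(real set \<Rightarrow> complex^'n^'n::finite) \<Rightarrow> bool" where
  "weight_matrix W \<longleftrightarrow>
     (\<forall>i j. complex_measure borel (\<lambda>\<Omega>. W \<Omega> $ i $ j)) \<and>
     (\<forall>\<Omega>\<in>sets borel. pos_semidef (W \<Omega>)) \<and>
     (\<forall>n i j. complex_integrable borel (\<lambda>\<Omega>. W \<Omega> $ i $ j) (\<lambda>t. complex_of_real (t ^ n))) \<and>
     (\<forall>P. invertible (mpoly_lead_coeff P) \<longrightarrow> invertible (matrix_integral W P P))"

definition dirac_matrix :: "real \<Rightarrow> complex^'n^'n \<Rightarrow> real set \<Rightarrow> complex^'n^'n" where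
  "dirac_matrix t0 M \<Omega> = indicator \<Omega> t0 *\<^sub>R M"

subsection \<open>Right-hand side differential operators\<close>

definition diff_op :: "nat \<Rightarrow> (nat \<Rightarrow> 'n::finite mpoly) \<Rightarrow> 'n mpoly \<Rightarrow> 'n mpoly" where
  "diff_op k F P = (\<Sum>i\<le>k. (mpoly_deriv ^^ i) P ** F i)"

definition symmetric_wrt ::
    "('n::finite mpoly \<Rightarrow> 'n mpoly) \<Rightarrow> (real set \<Rightarrow> complex^'n^'n) \<Rightarrow> bool" where
  "symmetric_wrt D W \<longleftrightarrow>
     (\<forall>P Q. matrix_integral W (D P) Q = matrix_integral W P (D Q))"

end

theory Submission
  imports Defs
begin

text \<open>
  Adding the point mass \<open>M\<close> at \<open>t0\<close> changes the sesquilinear form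
  \<open>(P, Q) \<mapsto> \<integral> P dW Q\<^sup>*\<close> by the single term \<open>P(t0) M Q(t0)\<^sup>*\<close>
  (\<open>matrix_integral_add_dirac\<close>).  The hypotheses on \<open>F\<^sub>j(t0) M\<close> kill every derivative in
  \<open>(P D)(t0) M\<close>, so that \<open>(P D)(t0) M = P(t0) F\<^sub>0(t0) M\<close>; since \<open>M\<close> and \<open>F\<^sub>0(t0) M\<close>
  are Hermitian, the operator is always symmetric for the added term
  (\<open>diff_op_dirac_symmetric\<close>).  Hence symmetry with respect to the two weights is the same
  condition.

  The analytic content is the first claim, because the integral against a complex measure goes through
  the Jordan decompositions of its real and imaginary parts, which are not additive in the measure.
  However, two signed measures that agree off the point \<open>a\<close> have positive variations that agree off
  \<open>a\<close>, and the positive minus the negative variation of \<open>{a}\<close> is the mass of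
  \<open>{a}\<close>.  Splitting every integral at \<open>a\<close> therefore yields the result
  (\<open>signed_integral_change_at_point\<close>).  What has to be known about the positive
  variation is that the supremum defining it is countably additive
  (\<open>emeasure_pos_variation\<close>), which follows from the definition without a Hahn decomposition.
\<close>

section \<open>The positive variation of a signed measure\<close>

text \<open>Finite, countably additive real set functions on the measurable sets of \<open>M\<close>; only the
  \<open>\<sigma>\<close>-algebra of \<open>M\<close> is used.\<close>

definition signed_measure :: "'a measure \<Rightarrow> ('a set \<Rightarrow> real) \<Rightarrow> bool" where
  "signed_measure M \<nu> \<longleftrightarrow>
     \<nu> {} = 0 \<and>
     (\<forall>A :: nat \<Rightarrow> 'a set. range A \<subseteq> sets M \<longrightarrow> disjoint_family A \<longrightarrow>
        (\<lambda>n. \<nu> (A n)) sums \<nu> (\<Union>n. A n))"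

lemma signed_measure_Re: "complex_measure M \<nu> \<Longrightarrow> signed_measure M (\<lambda>A. Re (\<nu> A))"
  and signed_measure_Im: "complex_measure M \<nu> \<Longrightarrow> signed_measure M (\<lambda>A. Im (\<nu> A))"
  by (auto simp: complex_measure_def signed_measure_def intro: sums_Re sums_Im)

lemma signed_measure_uminus: "signed_measure M \<nu> \<Longrightarrow> signed_measure M (\<lambda>A. - \<nu> A)"
  by (auto simp: signed_measure_def intro: sums_minus)

lemma signed_measure_Un:
  assumes "signed_measure M \<nu>" "A \<in> sets M" "B \<in> sets M" "A \<inter> B = {}"
  shows "\<nu> (A \<union> B) = \<nu> A + \<nu> B"
proof -
  have "range (binaryset A B) \<subseteq> sets M" "disjoint_family (binaryset A B)"
    using assms by (auto simp: binaryset_def disjoint_family_on_def)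
  then have "(\<lambda>n. \<nu> (binaryset A B n)) sums \<nu> (A \<union> B)"
    using assms(1) by (auto simp: signed_measure_def UN_binaryset_eq[symmetric])
  moreover have "(\<lambda>n. \<nu> (binaryset A B n)) sums (\<nu> A + \<nu> B)"
    using assms(1) by (intro binaryset_sums) (simp add: signed_measure_def)
  ultimately show ?thesis by (rule sums_unique2)
qed

text \<open>The set function from which the positive variation is generated.\<close>

abbreviation sup_variation :: "'a measure \<Rightarrow> ('a set \<Rightarrow> real) \<Rightarrow> 'a set \<Rightarrow> ennreal" where
  "sup_variation M \<nu> A \<equiv> (SUP B\<in>{B \<in> sets M. B \<subseteq> A}. ennreal (\<nu> B))"

lemma sup_variation_superadditive:
  assumes \<nu>: "signed_measure M \<nu>" and "A \<in> sets M" "B \<in> sets M" "A \<inter> B = {}"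
  shows "sup_variation M \<nu> A + sup_variation M \<nu> B \<le> sup_variation M \<nu> (A \<union> B)"
proof -
  have nonempty: "{C \<in> sets M. C \<subseteq> E} \<noteq> {}" for E
    using sets.empty_sets[of M] by blast
  have "ennreal (\<nu> C) + ennreal (\<nu> D) \<le> sup_variation M \<nu> (A \<union> B)"
    if C: "C \<in> sets M" "C \<subseteq> A" and D: "D \<in> sets M" "D \<subseteq> B" for C D
  proof -
    \<comment> \<open>A set of negative value may be replaced by the empty set.\<close>
    define C' where "C' = (if \<nu> C < 0 then {} else C)"
    define D' where "D' = (if \<nu> D < 0 then {} else D)"
    have nonneg: "ennreal (\<nu> C) = ennreal (\<nu> C')" "0 \<le> \<nu> C'"
      "ennreal (\<nu> D) = ennreal (\<nu> D')" "0 \<le> \<nu> D'"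
      using \<nu> by (auto simp: C'_def D'_def signed_measure_def ennreal_neg)
    have sets: "C' \<in> sets M" "D' \<in> sets M" "C' \<subseteq> A" "D' \<subseteq> B"
      using C D by (auto simp: C'_def D'_def)
    have "\<nu> (C' \<union> D') = \<nu> C' + \<nu> D'"
      using sets assms(4) by (intro signed_measure_Un[OF \<nu>]) auto
    then have "ennreal (\<nu> C) + ennreal (\<nu> D) = ennreal (\<nu> (C' \<union> D'))"
      using nonneg by simp
    also have "\<dots> \<le> sup_variation M \<nu> (A \<union> B)"
      using sets by (intro SUP_upper) auto
    finally show ?thesis .
  qed
  then have "ennreal (\<nu> C) + sup_variation M \<nu> B \<le> sup_variation M \<nu> (A \<union> B)"
    if "C \<in> sets M" "C \<subseteq> A" for C
    using that nonempty by (subst ennreal_SUP_add_right) (auto intro!: SUP_least)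
  then show ?thesis
    using nonempty by (subst ennreal_SUP_add_left[symmetric]) (auto intro!: SUP_least)
qed

lemma measure_space_sup_variation:
  assumes \<nu>: "signed_measure M \<nu>"
  shows "measure_space (space M) (sets M) (sup_variation M \<nu>)"
proof -
  have empty: "sup_variation M \<nu> {} = 0"
  proof -
    have "{B \<in> sets M. B \<subseteq> {}} = {{}}" by auto
    then show ?thesis using \<nu> by (simp add: signed_measure_def)
  qed
  have "(\<Sum>n. sup_variation M \<nu> (A n)) = sup_variation M \<nu> (\<Union>n. A n)"
    if A: "range A \<subseteq> sets M" and disj: "disjoint_family A" for A :: "nat \<Rightarrow> 'a set"
  proof (rule antisym)
    have "(\<Sum>n<m. sup_variation M \<nu> (A n)) \<le> sup_variation M \<nu> (\<Union>n<m. A n)" for m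
    proof (induction m)
      case (Suc m)
      have "(\<Sum>n<Suc m. sup_variation M \<nu> (A n))
          \<le> sup_variation M \<nu> (\<Union>n<m. A n) + sup_variation M \<nu> (A m)"
        unfolding sum.lessThan_Suc by (rule add_right_mono[OF Suc])
      also have "\<dots> \<le> sup_variation M \<nu> ((\<Union>n<m. A n) \<union> A m)"
      proof (rule sup_variation_superadditive[OF \<nu>])
        show "(\<Union>n<m. A n) \<in> sets M" "A m \<in> sets M"
          using A by auto
        have "A n \<inter> A m = {}" if "n < m" for n
          using disj that by (simp add: disjoint_family_on_def)
        then show "(\<Union>n<m. A n) \<inter> A m = {}"
          by blast
      qed
      also have "(\<Union>n<m. A n) \<union> A m = (\<Union>n<Suc m. A n)"
        by (auto simp: less_Suc_eq)
      finally show ?case .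
    qed (simp add: empty)
    moreover have "sup_variation M \<nu> (\<Union>n<m. A n) \<le> sup_variation M \<nu> (\<Union>n. A n)" for m
      by (intro SUP_subset_mono) auto
    ultimately have "(\<Sum>n<m. sup_variation M \<nu> (A n)) \<le> sup_variation M \<nu> (\<Union>n. A n)" for m
      by (rule order_trans)
    then show "(\<Sum>n. sup_variation M \<nu> (A n)) \<le> sup_variation M \<nu> (\<Union>n. A n)"
      by (intro suminf_le_const) simp_all
  next
    show "sup_variation M \<nu> (\<Union>n. A n) \<le> (\<Sum>n. sup_variation M \<nu> (A n))"
    proof (rule SUP_least)
      fix B assume B: "B \<in> {B \<in> sets M. B \<subseteq> (\<Union>n. A n)}"
      have "range (\<lambda>n. B \<inter> A n) \<subseteq> sets M" "disjoint_family (\<lambda>n. B \<inter> A n)"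
        using A B disj by (auto simp: disjoint_family_on_def)
      then have "(\<lambda>n. \<nu> (B \<inter> A n)) sums \<nu> (\<Union>n. B \<inter> A n)"
        using \<nu> unfolding signed_measure_def by blast
      also have "(\<Union>n. B \<inter> A n) = B" using B by auto
      finally have sums: "(\<lambda>n. \<nu> (B \<inter> A n)) sums \<nu> B" .
      have "ennreal (\<nu> B) \<le> (\<Sum>n. ennreal (\<nu> (B \<inter> A n)))"
      proof (rule LIMSEQ_le_const2)
        show "(\<lambda>m. ennreal (\<Sum>n<m. \<nu> (B \<inter> A n))) \<longlonglongrightarrow> ennreal (\<nu> B)"
          using sums by (intro tendsto_ennrealI) (simp add: sums_def)
        have "ennreal (\<Sum>n<m. \<nu> (B \<inter> A n)) \<le> (\<Sum>n. ennreal (\<nu> (B \<inter> A n)))" for m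
        proof -
          have "ennreal (\<Sum>n<m. \<nu> (B \<inter> A n)) \<le> ennreal (\<Sum>n<m. max 0 (\<nu> (B \<inter> A n)))"
            by (intro ennreal_leI sum_mono) simp
          also have "\<dots> = (\<Sum>n<m. ennreal (\<nu> (B \<inter> A n)))"
            by (simp add: ennreal_max_0 flip: sum_ennreal)
          also have "\<dots> \<le> (\<Sum>n. ennreal (\<nu> (B \<inter> A n)))"
            by (intro sum_le_suminf) auto
          finally show ?thesis .
        qed
        then show "\<exists>N. \<forall>m\<ge>N. ennreal (\<Sum>n<m. \<nu> (B \<inter> A n)) \<le> (\<Sum>n. ennreal (\<nu> (B \<inter> A n)))"
          by blast
      qed
      also have "\<dots> \<le> (\<Sum>n. sup_variation M \<nu> (A n))"
        using A B by (intro suminf_le SUP_upper) auto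
      finally show "ennreal (\<nu> B) \<le> (\<Sum>n. sup_variation M \<nu> (A n))" .
    qed
  qed
  then show ?thesis
    using empty
    by (auto simp: measure_space_def positive_def countably_additive_def
        intro: sets.sigma_algebra_axioms)
qed

lemma sets_pos_variation [measurable_cong]: "sets (pos_variation M \<nu>) = sets M"
  and space_pos_variation: "space (pos_variation M \<nu>) = space M"
  by (simp_all add: pos_variation_def sets.space_closed)

lemma emeasure_pos_variation:
  assumes "signed_measure M \<nu>" "A \<in> sets M"
  shows "emeasure (pos_variation M \<nu>) A = sup_variation M \<nu> A"
  using measure_space_sup_variation[OF assms(1)] assms(2)
  unfolding pos_variation_def measure_space_def
  by (intro emeasure_measure_of_sigma) auto

section \<open>Changing a measure at one point\<close>

lemma emeasure_pos_variation_singleton: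
  assumes \<nu>: "signed_measure M \<nu>" and "{a} \<in> sets M"
  shows "emeasure (pos_variation M \<nu>) {a} = ennreal (max 0 (\<nu> {a}))"
proof -
  have "{B \<in> sets M. B \<subseteq> {a}} = {{}, {a}}"
    using assms(2) by auto
  then have "emeasure (pos_variation M \<nu>) {a} = sup (ennreal (\<nu> {})) (ennreal (\<nu> {a}))"
    using assms by (simp add: emeasure_pos_variation)
  also have "\<dots> = ennreal (max 0 (\<nu> {a}))"
    using \<nu> by (simp add: signed_measure_def sup_max ennreal_max_0 max_def ennreal_neg)
  finally show ?thesis .
qed

lemma restrict_pos_variation_eq:
  assumes "signed_measure M \<nu>" "signed_measure M \<nu>'" "{a} \<in> sets M"
    and eq: "\<And>A. A \<in> sets M \<Longrightarrow> a \<notin> A \<Longrightarrow> \<nu> A = \<nu>' A"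
  shows "restrict_space (pos_variation M \<nu>) (- {a}) = restrict_space (pos_variation M \<nu>') (- {a})"
proof (rule measure_eqI)
  have *: "- {a} \<inter> space M = space M - {a}" by auto
  fix A assume "A \<in> sets (restrict_space (pos_variation M \<nu>) (- {a}))"
  then have A: "A \<in> sets M" "A \<subseteq> - {a}"
    using assms(3) by (auto simp: sets_restrict_space sets_pos_variation Diff_eq[symmetric] Int_commute)
  have "sup_variation M \<nu> A = sup_variation M \<nu>' A"
    using A(2) by (intro SUP_cong) (auto intro!: arg_cong[where f = ennreal] eq)
  then show "emeasure (restrict_space (pos_variation M \<nu>) (- {a})) A =
      emeasure (restrict_space (pos_variation M \<nu>') (- {a})) A"
    using A assms(1-3)
    by (simp add: emeasure_restrict_space emeasure_pos_variation sets_pos_variation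
        space_pos_variation * sets.compl_sets)
qed (simp add: sets_restrict_space sets_pos_variation)

text \<open>The part of the integral at \<open>a\<close> always exists, because the variation of \<open>{a}\<close> is finite
  by \<open>emeasure_pos_variation_singleton\<close>.\<close>

lemma integral_pos_variation_split:
  fixes f :: "'a \<Rightarrow> complex"
  assumes \<nu>: "signed_measure M \<nu>" and a: "{a} \<in> sets M"
    and f: "f \<in> borel_measurable M"
    and int: "integrable (restrict_space (pos_variation M \<nu>) (- {a})) f"
  shows "(LINT x|pos_variation M \<nu>. f x) =
    (LINT x|restrict_space (pos_variation M \<nu>) (- {a}). f x) + of_real (max 0 (\<nu> {a})) * f a"
proof -
  let ?p = "pos_variation M \<nu>"
  have sets: "- {a} \<inter> space ?p \<in> sets ?p"
  proof -
    have "- {a} \<inter> space ?p = space M - {a}" by (auto simp: space_pos_variation)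
    then show ?thesis using a by (simp add: sets_pos_variation)
  qed
  have a': "{a} \<in> sets ?p" using a by (simp add: sets_pos_variation)
  have fin: "emeasure ?p {a} < \<infinity>"
    using emeasure_pos_variation_singleton[OF \<nu> a] by simp
  have "(LINT x|?p. f x) = (LINT x|?p. indicator (- {a}) x *\<^sub>R f x + indicator {a} x *\<^sub>R f a)"
    by (intro Bochner_Integration.integral_cong) (auto simp: indicator_def)
  also have "\<dots> = (LINT x|?p. indicator (- {a}) x *\<^sub>R f x) + (LINT x|?p. indicator {a} x *\<^sub>R f a)"
    using int a' fin sets
    by (intro Bochner_Integration.integral_add) (auto simp: integrable_restrict_space)
  also have "(LINT x|?p. indicator (- {a}) x *\<^sub>R f x) = (LINT x|restrict_space ?p (- {a}). f x)"
    using sets by (simp add: integral_restrict_space)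
  also have "(LINT x|?p. indicator {a} x *\<^sub>R f a) = measure ?p {a} *\<^sub>R f a"
    using a' fin by simp
  also have "measure ?p {a} = max 0 (\<nu> {a})"
    using emeasure_pos_variation_singleton[OF \<nu> a] by (simp add: measure_def)
  finally show ?thesis by (simp add: scaleR_conv_of_real)
qed

lemma signed_integral_change_at_point:
  assumes \<nu>: "signed_measure M \<nu>" and \<nu>': "signed_measure M \<nu>'" and a: "{a} \<in> sets M"
    and eq: "\<And>A. A \<in> sets M \<Longrightarrow> a \<notin> A \<Longrightarrow> \<nu>' A = \<nu> A"
    and int: "signed_integrable M \<nu> f"
  shows "signed_integral M \<nu>' f = signed_integral M \<nu> f + of_real (\<nu>' {a} - \<nu> {a}) * f a"
proof -
  \<comment> \<open>The part of the integral away from \<open>a\<close> is the same for both measures.\<close>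
  have change: "(LINT x|pos_variation M \<mu>'. f x) = (LINT x|pos_variation M \<mu>. f x)
      + of_real (max 0 (\<mu>' {a}) - max 0 (\<mu> {a})) * f a"
    if "signed_measure M \<mu>" "signed_measure M \<mu>'" "\<And>A. A \<in> sets M \<Longrightarrow> a \<notin> A \<Longrightarrow> \<mu>' A = \<mu> A"
      and int: "integrable (pos_variation M \<mu>) f" for \<mu> \<mu>'
  proof -
    have f: "f \<in> borel_measurable M"
      using borel_measurable_integrable[OF int]
      by (simp add: measurable_cong_sets[OF sets_pos_variation refl])
    have "- {a} \<inter> space M = space M - {a}" by auto
    then have sets: "- {a} \<inter> space M \<in> sets M" using a by simp
    then have "integrable (pos_variation M \<mu>) (\<lambda>x. indicator (- {a} \<inter> space M) x *\<^sub>R f x)"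
      using int by (intro integrable_mult_indicator) (simp_all add: sets_pos_variation)
    also have "?this \<longleftrightarrow> integrable (pos_variation M \<mu>) (\<lambda>x. indicator (- {a}) x *\<^sub>R f x)"
      by (intro Bochner_Integration.integrable_cong) (auto simp: space_pos_variation indicator_def)
    finally have restr: "integrable (restrict_space (pos_variation M \<mu>) (- {a})) f"
      using sets by (simp add: integrable_restrict_space space_pos_variation sets_pos_variation)
    have "restrict_space (pos_variation M \<mu>') (- {a}) = restrict_space (pos_variation M \<mu>) (- {a})"
      by (intro restrict_pos_variation_eq that a)
    then show ?thesis
      using integral_pos_variation_split[OF that(1) a f restr]
        integral_pos_variation_split[OF that(2) a f] restr
      by (simp add: algebra_simps)
  qed
  have pos: "(LINT x|pos_variation M \<nu>'. f x) = (LINT x|pos_variation M \<nu>. f x)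
      + of_real (max 0 (\<nu>' {a}) - max 0 (\<nu> {a})) * f a"
    using int by (intro change \<nu> \<nu>' eq) (auto simp: signed_integrable_def)
  have neg: "(LINT x|pos_variation M (\<lambda>A. - \<nu>' A). f x) = (LINT x|pos_variation M (\<lambda>A. - \<nu> A). f x)
      + of_real (max 0 (- \<nu>' {a}) - max 0 (- \<nu> {a})) * f a"
    using int eq by (intro change signed_measure_uminus \<nu> \<nu>') (auto simp: signed_integrable_def)
  have mass: "\<nu>' {a} - \<nu> {a} =
      (max 0 (\<nu>' {a}) - max 0 (\<nu> {a})) - (max 0 (- \<nu>' {a}) - max 0 (- \<nu> {a}))"
    by (simp add: max_def)
  show ?thesis
    unfolding signed_integral_def pos neg mass of_real_diff by (simp add: algebra_simps)
qed

lemma complex_measure_add_dirac: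
  assumes "complex_measure M \<nu>"
  shows "complex_measure M (\<lambda>A. \<nu> A + indicator A a *\<^sub>R c)"
  unfolding complex_measure_def
proof (intro conjI allI impI)
  fix A :: "nat \<Rightarrow> 'a set"
  assume A: "range A \<subseteq> sets M" "disjoint_family A"
  have "(\<lambda>n. indicator (A n) a :: real) sums indicator (\<Union>n. A n) a"
    using A(2) by (intro indicator_sums) (auto simp: disjoint_family_on_def)
  then have "(\<lambda>n. indicator (A n) a *\<^sub>R c) sums (indicator (\<Union>n. A n) a *\<^sub>R c)"
    by (rule sums_scaleR_left)
  then show "(\<lambda>n. \<nu> (A n) + indicator (A n) a *\<^sub>R c) sums
      (\<nu> (\<Union>n. A n) + indicator (\<Union>n. A n) a *\<^sub>R c)"
    using assms A by (intro sums_add) (auto simp: complex_measure_def)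
qed (use assms in \<open>simp add: complex_measure_def\<close>)

lemma complex_integral_add_dirac:
  assumes \<nu>: "complex_measure M \<nu>" and a: "{a} \<in> sets M" and int: "complex_integrable M \<nu> f"
  shows "complex_integral M (\<lambda>A. \<nu> A + indicator A a *\<^sub>R c) f = complex_integral M \<nu> f + c * f a"
proof -
  let ?\<nu>' = "\<lambda>A. \<nu> A + indicator A a *\<^sub>R c"
  note \<nu>' = complex_measure_add_dirac[OF \<nu>, of a c]
  have "signed_integral M (\<lambda>A. Re (?\<nu>' A)) f
      = signed_integral M (\<lambda>A. Re (\<nu> A)) f + of_real (Re (?\<nu>' {a}) - Re (\<nu> {a})) * f a"
    using int by (intro signed_integral_change_at_point signed_measure_Re \<nu> \<nu>' a)
      (auto simp: complex_integrable_def)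
  moreover have "signed_integral M (\<lambda>A. Im (?\<nu>' A)) f
      = signed_integral M (\<lambda>A. Im (\<nu> A)) f + of_real (Im (?\<nu>' {a}) - Im (\<nu> {a})) * f a"
    using int by (intro signed_integral_change_at_point signed_measure_Im \<nu> \<nu>' a)
      (auto simp: complex_integrable_def)
  moreover have "c * f a = of_real (Re c) * f a + \<i> * (of_real (Im c) * f a)"
    by (metis complex_eq distrib_right mult.assoc)
  ultimately show ?thesis
    by (simp add: complex_integral_def algebra_simps)
qed

section \<open>Integrals of matrix polynomials\<close>

lemma complex_integrable_poly:
  assumes "\<And>n. complex_integrable M \<nu> (\<lambda>t. complex_of_real (t ^ n))"
  shows "complex_integrable M \<nu> (\<lambda>t. poly p (complex_of_real t))"
  using assms
  by (simp add: poly_altdef complex_integrable_def signed_integrable_def)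

lemma complex_integrable_mpoly_product:
  assumes "weight_matrix W"
  shows "complex_integrable borel (\<lambda>\<Omega>. W \<Omega> $ k $ l)
    (\<lambda>t. mpoly_eval P t $ i $ k * ctranspose (mpoly_eval Q t) $ l $ j)"
proof -
  have cnj: "poly (map_poly cnj q) (of_real t) = cnj (poly q (of_real t))" for q t
    using poly_cnj[of q "of_real t"] by simp
  have eq: "(\<lambda>t. mpoly_eval P t $ i $ k * ctranspose (mpoly_eval Q t) $ l $ j) =
      (\<lambda>t. poly (P $ i $ k * map_poly cnj (Q $ j $ l)) (complex_of_real t))"
    by (simp add: mpoly_eval_def ctranspose_def map_matrix_def cnj)
  have "complex_integrable borel (\<lambda>\<Omega>. W \<Omega> $ k $ l) (\<lambda>t. complex_of_real (t ^ n))" for n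
    using assms by (simp only: weight_matrix_def)
  then show ?thesis
    unfolding eq by (rule complex_integrable_poly)
qed

text \<open>The finite moments of \<open>W\<close> make every integrand integrable; without that the integrals would be
  default values, which do not split at \<open>t0\<close>.\<close>

lemma matrix_integral_add_dirac:
  assumes W: "weight_matrix W"
  shows "matrix_integral (\<lambda>\<Omega>. W \<Omega> + dirac_matrix t0 M \<Omega>) P Q =
    matrix_integral W P Q + mpoly_eval P t0 ** M ** ctranspose (mpoly_eval Q t0)"
proof -
  have "complex_integral borel (\<lambda>\<Omega>. (W \<Omega> + dirac_matrix t0 M \<Omega>) $ k $ l)
        (\<lambda>t. mpoly_eval P t $ i $ k * ctranspose (mpoly_eval Q t) $ l $ j) =
      complex_integral borel (\<lambda>\<Omega>. W \<Omega> $ k $ l)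
        (\<lambda>t. mpoly_eval P t $ i $ k * ctranspose (mpoly_eval Q t) $ l $ j)
      + M $ k $ l * (mpoly_eval P t0 $ i $ k * ctranspose (mpoly_eval Q t0) $ l $ j)" for i j k l
    using complex_integral_add_dirac[OF _ _ complex_integrable_mpoly_product[OF W], of k l t0 "M $ k $ l"] W
    by (simp add: dirac_matrix_def weight_matrix_def)
  moreover have "(\<Sum>k\<in>UNIV. \<Sum>l\<in>UNIV.
        M $ k $ l * (mpoly_eval P t0 $ i $ k * ctranspose (mpoly_eval Q t0) $ l $ j)) =
      (mpoly_eval P t0 ** M ** ctranspose (mpoly_eval Q t0)) $ i $ j" for i j
    by (subst sum.swap)
      (simp add: matrix_matrix_mult_def sum_distrib_right mult.assoc mult.left_commute)
  ultimately show ?thesis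
    by (simp add: matrix_integral_def vec_eq_iff sum.distrib)
qed

section \<open>Symmetry with respect to a point mass\<close>

lemma ctranspose_mult: "ctranspose (A ** B) = ctranspose B ** ctranspose A"
  by (simp add: ctranspose_def matrix_matrix_mult_def vec_eq_iff mult.commute)

lemma mpoly_eval_mult: "mpoly_eval (P ** Q) t = mpoly_eval P t ** mpoly_eval Q t"
  by (simp add: mpoly_eval_def map_matrix_def matrix_matrix_mult_def vec_eq_iff poly_sum)

lemma mpoly_eval_sum: "mpoly_eval (\<Sum>i\<in>I. P i) t = (\<Sum>i\<in>I. mpoly_eval (P i) t)"
  by (simp add: mpoly_eval_def map_matrix_def vec_eq_iff poly_sum)

lemma sum_matrix_mult: "(\<Sum>i\<in>I. A i) ** B = (\<Sum>i\<in>I. A i ** B)"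
  for A :: "'i \<Rightarrow> 'a::semiring_1^'n^'m"
  by (simp add: matrix_matrix_mult_def vec_eq_iff sum_distrib_right sum.swap[of _ UNIV I])

text \<open>Multiplication by \<open>M\<close> removes every derivative of \<open>P\<close> from the value of \<open>P D\<close> at \<open>t\<close>.\<close>

lemma diff_op_eval_mult:
  assumes "\<And>j. 1 \<le> j \<Longrightarrow> j \<le> k \<Longrightarrow> mpoly_eval (F j) t ** M = 0"
  shows "mpoly_eval (diff_op k F P) t ** M = mpoly_eval P t ** mpoly_eval (F 0) t ** M"
proof -
  have "mpoly_eval (diff_op k F P) t ** M =
      (\<Sum>i\<le>k. mpoly_eval ((mpoly_deriv ^^ i) P) t ** (mpoly_eval (F i) t ** M))"
    by (simp add: diff_op_def mpoly_eval_sum mpoly_eval_mult sum_matrix_mult matrix_mul_assoc)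
  also have "\<dots> = (\<Sum>i\<in>{0}. mpoly_eval ((mpoly_deriv ^^ i) P) t ** (mpoly_eval (F i) t ** M))"
    using assms by (intro sum.mono_neutral_right) auto
  finally show ?thesis by (simp add: matrix_mul_assoc)
qed

lemma diff_op_dirac_symmetric:
  assumes M: "hermitian M"
    and F: "\<And>j. 1 \<le> j \<Longrightarrow> j \<le> k \<Longrightarrow> mpoly_eval (F j) t ** M = 0"
    and F0: "mpoly_eval (F 0) t ** M = M ** ctranspose (mpoly_eval (F 0) t)"
  shows "mpoly_eval (diff_op k F P) t ** M ** ctranspose (mpoly_eval Q t) =
    mpoly_eval P t ** M ** ctranspose (mpoly_eval (diff_op k F Q) t)"
proof -
  have "M ** ctranspose (mpoly_eval (diff_op k F Q) t)
      = ctranspose (mpoly_eval (diff_op k F Q) t ** M)"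
    using M by (simp add: ctranspose_mult hermitian_def)
  also have "\<dots> = M ** ctranspose (mpoly_eval (F 0) t) ** ctranspose (mpoly_eval Q t)"
    using M by (simp add: diff_op_eval_mult[OF F] ctranspose_mult hermitian_def matrix_mul_assoc)
  also have "\<dots> = mpoly_eval (F 0) t ** M ** ctranspose (mpoly_eval Q t)"
    by (simp only: F0)
  finally have "M ** ctranspose (mpoly_eval (diff_op k F Q) t)
      = mpoly_eval (F 0) t ** M ** ctranspose (mpoly_eval Q t)" .
  then show ?thesis
    by (simp add: diff_op_eval_mult[OF F] matrix_mul_assoc[symmetric])
qed

theorem theorem2p2:
  fixes k :: nat
    and F :: "nat \<Rightarrow> complex poly^'n^'n::finite"
    and W :: "real set \<Rightarrow> complex^'n^'n"
    and t0 :: real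
    and M :: "complex^'n^'n"
  assumes "\<And>i. i \<le> k \<Longrightarrow> mpoly_degree (F i) \<le> i"
    and "F k \<noteq> 0"
    and "weight_matrix W"
    and "pos_semidef M"
    and "\<And>j. 1 \<le> j \<Longrightarrow> j \<le> k \<Longrightarrow> mpoly_eval (F j) t0 ** M = 0"
    and "mpoly_eval (F 0) t0 ** M = M ** ctranspose (mpoly_eval (F 0) t0)"
  shows "symmetric_wrt (diff_op k F) W \<longleftrightarrow>
         symmetric_wrt (diff_op k F) (\<lambda>\<Omega>. W \<Omega> + dirac_matrix t0 M \<Omega>)"
proof -
  have "hermitian M" using assms(4) by (simp add: pos_semidef_def)
  then show ?thesis
    using diff_op_dirac_symmetric[of M k F t0] assms(5,6)
    by (simp add: symmetric_wrt_def matrix_integral_add_dirac[OF assms(3)])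
qed

end
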